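(* For every integer $l\ge 2$, $$(1+o(1))\,(2l+1)\,\frac{m^{l}}{(2l+1)^{l}} \le \rho(P_{2l},m) \le \frac{m^{l}}{2(l-1)^{l-1}},$$ where the upper bound holds for every positive integer $m$, and in the lower bound $o(1)$ denotes a quantity tending to $0$ as $m\to\infty$ with $l$ fixed.
   Context: Graphs are finite, simple and undirected. $P_k$ denotes the path on $k$ vertices. For graphs $G$ and $H$, $c(G,H)$ is the number of induced copies of $H$ in $G$, i.e. the number of subsets $S\subseteq V(G)$ such that the induced subgraph $G[S]$ is isomorphic to $H$. For a positive integer $m$, $\rho(H,m)=\max\{c(G,H) : G \text{ a graph with } |E(G)|=m\}$ (the number of vertices of $G$ is not restricted). *)

theory Defs
  imports Complex_Main
begin

type_synonym 'a graph = "'a set \<times> 'a set set"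

abbreviation verts :: "'a graph \<Rightarrow> 'a set" where
  "verts G \<equiv> fst G"

abbreviation edges :: "'a graph \<Rightarrow> 'a set set" where
  "edges G \<equiv> snd G"

definition simple_graph :: "'a graph \<Rightarrow> bool" where
  "simple_graph G \<longleftrightarrow>
     finite (verts G) \<and> (\<forall>e\<in>edges G. e \<subseteq> verts G \<and> card e = 2)"

definition induced_subgraph :: "'a graph \<Rightarrow> 'a set \<Rightarrow> 'a graph" where
  "induced_subgraph G S = (S, {e \<in> edges G. e \<subseteq> S})"

definition graph_iso :: "'a graph \<Rightarrow> 'b graph \<Rightarrow> bool" where
  "graph_iso G H \<longleftrightarrow>
     (\<exists>f. bij_betw f (verts G) (verts H) \<and>
          (\<forall>u\<in>verts G. \<forall>v\<in>verts G. {u, v} \<in> edges G \<longleftrightarrow> {f u, f v} \<in> edges H))"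

definition path_graph :: "nat \<Rightarrow> nat graph" where
  "path_graph k = ({..<k}, {{i, Suc i} | i. Suc i < k})"

definition induced_copies :: "'a graph \<Rightarrow> 'b graph \<Rightarrow> nat" where
  "induced_copies G H = card {S. S \<subseteq> verts G \<and> graph_iso (induced_subgraph G S) H}"

text \<open>
  Every finite graph is isomorphic to one with vertices in \<open>nat\<close>, so letting \<open>G\<close> range over
  graphs on finite sets of naturals loses nothing. The number of vertices of \<open>G\<close> is not
  restricted, so the set below can be infinite, in which case \<open>Max\<close> is meaningless. When \<open>H\<close>
  has no isolated vertices, as for paths on at least two vertices, it is finite: every induced
  copy lies in the set of at most \<open>2 * m\<close> endpoints of edges of \<open>G\<close> (proved below for paths).
\<close>

definition max_induced_copies :: "'b graph \<Rightarrow> nat \<Rightarrow> nat" where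
  "max_induced_copies H m =
     Max {induced_copies G H | G :: nat graph. simple_graph G \<and> card (edges G) = m}"

lemma finite_induced_copies_path_graph:
  assumes "k \<ge> 2"
  shows "finite {induced_copies G (path_graph k) | G :: nat graph. simple_graph G \<and> card (edges G) = m}"
proof (rule finite_subset)
  show "{induced_copies G (path_graph k) | G :: nat graph. simple_graph G \<and> card (edges G) = m} \<subseteq> {..2^(2*m)}"
  proof
    fix n assume "n \<in> {induced_copies G (path_graph k) | G :: nat graph. simple_graph G \<and> card (edges G) = m}"
    then obtain V :: "nat set" and E where n: "n = induced_copies (V,E) (path_graph k)"
      and G: "simple_graph (V,E)" and m: "card E = m" by auto
    have fE: "finite E" using G unfolding simple_graph_def
      by (intro finite_subset[of E "Pow V"]) auto
    have fU: "finite (\<Union>E)" using G unfolding simple_graph_def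
      by (intro finite_subset[of "\<Union>E" V]) auto
    have cU: "card (\<Union>E) \<le> 2 * card E"
    proof -
      have "card (\<Union>E) \<le> sum card E" by (rule card_Union_le_sum_card)
      also have "\<dots> = 2 * card E" using G by (simp add: simple_graph_def)
      finally show ?thesis .
    qed
    have sub: "{S. S \<subseteq> verts (V,E) \<and> graph_iso (induced_subgraph (V,E) S) (path_graph k)} \<subseteq> Pow (\<Union>E)"
    proof clarify
      fix S x assume "graph_iso (induced_subgraph (V,E) S) (path_graph k)" and x: "x \<in> S"
      then obtain f where f: "bij_betw f S {..<k}"
        and e: "\<And>u v. u\<in>S \<Longrightarrow> v\<in>S \<Longrightarrow> ({u,v} \<in> E \<and> u \<in> S \<and> v \<in> S) \<longleftrightarrow> {f u, f v} \<in> edges (path_graph k)"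
        unfolding graph_iso_def induced_subgraph_def path_graph_def by auto
      have fx: "f x < k" using f x by (auto simp: bij_betw_def)
      obtain j where j: "j < k" "{f x, j} \<in> edges (path_graph k)"
      proof (cases "Suc (f x) < k")
        case True then show ?thesis by (intro that[of "Suc (f x)"]) (auto simp: path_graph_def)
      next
        case False
        then have "{f x, f x - 1} = {f x - 1, Suc (f x - 1)}" "Suc (f x - 1) < k" using assms fx by auto
        then show ?thesis by (intro that[of "f x - 1"]) (auto simp: path_graph_def)
      qed
      obtain y where "y \<in> S" "f y = j" using f j(1) by (metis bij_betw_iff_bijections lessThan_iff)
      then have "{x,y} \<in> E" using e[of x y] x j by auto
      then show "x \<in> \<Union>E" by blast
    qed
    have "induced_copies (V,E) (path_graph k) \<le> card (Pow (\<Union>E))"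
      unfolding induced_copies_def using sub fU by (intro card_mono) auto
    also have "\<dots> \<le> 2^(2*card E)" using cU fU by (simp add: card_Pow)
    finally show "n \<in> {..2^(2*m)}" using n m by simp
  qed
qed simp

end

theory Submission
  imports Defs "HOL-Library.FuncSet"
begin

text \<open>
  Upper bound: an induced path on \<open>2 * l\<close> vertices is covered by its \<open>l\<close> alternate edges, read in
  either of the two directions. Call two edges of \<open>G\<close> related if some edge of \<open>G\<close> joins them; then
  such a sequence of edges \<open>e\<^sub>1, \<dots>, e\<^sub>l\<close> has \<open>e\<^sub>i\<close> and \<open>e\<^sub>j\<close> (\<open>i < j\<close>) related iff \<open>j = i + 1\<close>.
  There are \<open>m\<close> choices of \<open>e\<^sub>1\<close>, and \<open>e\<^sub>i\<^sub>+\<^sub>1\<close> lies in the set of neighbours of \<open>e\<^sub>i\<close> that are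
  not neighbours of any earlier term. These \<open>l - 1\<close> sets are disjoint subsets of the edge set, so by the
  AM-GM inequality there are at most \<open>m * (m / (l - 1)) ^ (l - 1)\<close> sequences.

  Lower bound: blow up the cycle on \<open>2 * l + 1\<close> vertices, with parts as large as \<open>m\<close> edges permit.
  A transversal of all parts but one induces a path on \<open>2 * l\<close> vertices.
\<close>

section \<open>The upper bound\<close>

text \<open>AM-GM for \<open>d\<close> and \<open>n\<close> copies of \<open>(M - d) / n\<close>,
  whose mean is \<open>M / Suc n\<close>. It drives the induction of the count: \<open>d\<close>
  candidates for the next term leave \<open>M - d\<close> elements for the \<open>n\<close> terms
  after it.\<close>

lemma mult_power_le_power_mean:
  fixes d M :: real
  assumes "0 \<le> d" "d \<le> M"
  shows "d * ((M - d) / real n) ^ n \<le> (M / real (Suc n)) ^ Suc n"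
proof (cases "n = 0 \<or> M = d")
  \<comment> \<open>For \<open>n = 0\<close> the power is 1, although its base divides by zero, and
    the claim is \<open>d \<le> M\<close>. For \<open>M = d\<close> and \<open>n > 0\<close> the
    left side vanishes.\<close>
  case True
  then show ?thesis using assms by (cases "n = 0") (auto simp: power_0_left)
next
  case False
  define a where "a = (M - d) / real n"
  have a: "a > 0" and M: "M = d + real n * a" using False assms by (auto simp: a_def)
  \<comment> \<open>Chosen so that the mean equals \<open>a * (1 + x)\<close> while
    \<open>d = a * (1 + Suc n * x)\<close>; Bernoulli's inequality then compares the two
    sides.\<close>
  define x where "x = (d - a) / (real (Suc n) * a)"
  have nx: "real (Suc n) * x = d / a - 1"
    using a by (simp add: x_def field_simps del: of_nat_Suc)
  have "d / a \<ge> 0" using a assms by simp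
  then have "real (Suc n) * x \<ge> real (Suc n) * (- 1)" using nx by simp
  then have x: "x \<ge> - 1" by (subst (asm) mult_le_cancel_left_pos) simp_all
  have "real (Suc n) * (a * (1 + x)) = a * real (Suc n) + a * (real (Suc n) * x)"
    by (simp add: algebra_simps)
  also have "\<dots> = M" unfolding nx using a M by (simp add: algebra_simps)
  finally have Mx: "M / real (Suc n) = a * (1 + x)"
    by (simp add: nonzero_divide_eq_eq mult.commute del: of_nat_Suc)
  have "d * a ^ n = a ^ Suc n * (1 + real (Suc n) * x)"
    unfolding nx using a by simp
  also have "\<dots> \<le> a ^ Suc n * (1 + x) ^ Suc n"
    using a Bernoulli_inequality[OF x, of "Suc n"] by (intro mult_left_mono) auto
  also have "\<dots> = (M / real (Suc n)) ^ Suc n" by (simp only: Mx power_mult_distrib)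
  finally show ?thesis by (simp add: a_def)
qed

section \<open>Counting induced chains of a relation\<close>

definition induced_chain :: "('a \<Rightarrow> 'a \<Rightarrow> bool) \<Rightarrow> 'a list \<Rightarrow> bool" where
  "induced_chain R xs \<longleftrightarrow> (\<forall>i j. i < j \<longrightarrow> j < length xs \<longrightarrow> (R (xs ! i) (xs ! j) \<longleftrightarrow> j = Suc i))"

text \<open>\<open>v\<close> is the last term chosen and \<open>U\<close> holds the elements related
  to no term before \<open>v\<close>. Each step discards all candidates for its own term, so the
  candidate sets along one branch are disjoint.\<close>

fun continuations :: "('a \<Rightarrow> 'a \<Rightarrow> bool) \<Rightarrow> 'a \<Rightarrow> 'a set \<Rightarrow> nat \<Rightarrow> 'a list set" where
  "continuations R v U 0 = {[]}"
| "continuations R v U (Suc n) =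
     (\<Union>e\<in>{e\<in>U. R v e}. (#) e ` continuations R e {x\<in>U. \<not> R v x} n)"

text \<open>Among the terms after \<open>v\<close> only the first is related to \<open>v\<close>, so
  the others survive when the neighbours of \<open>v\<close> are removed from
  \<open>U\<close>.\<close>

lemma induced_chain_in_continuations:
  assumes "induced_chain R (v # xs)" "set xs \<subseteq> U"
  shows "xs \<in> continuations R v U (length xs)"
  using assms
proof (induction xs arbitrary: v U)
  case (Cons e xs)
  have *: "R ((v # e # xs) ! i) ((v # e # xs) ! j) \<longleftrightarrow> j = Suc i" if "i < j" "j < length (v # e # xs)" for i j
    using Cons.prems(1) that unfolding induced_chain_def by blast
  have "R v e" using *[of 0 1] by simp
  moreover have "\<not> R v x" if x: "x \<in> set xs" for x
  proof -
    obtain i where "i < length xs" "x = xs ! i" using x by (metis in_set_conv_nth)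
    then show ?thesis using *[of 0 "i + 2"] by simp
  qed
  moreover have "induced_chain R (e # xs)"
    unfolding induced_chain_def
  proof (intro allI impI)
    fix i j assume "i < j" "j < length (e # xs)"
    then show "R ((e # xs) ! i) ((e # xs) ! j) \<longleftrightarrow> j = Suc i"
      using *[of "Suc i" "Suc j"] by simp
  qed
  ultimately show ?case using Cons.prems(2) Cons.IH[of e "{x\<in>U. \<not> R v x}"] by auto
qed simp

text \<open>\<open>U\<close> splits into the neighbours of \<open>v\<close> and the rest. Every
  neighbour leaves the same rest, and the induction bound depends only on its size, so AM-GM closes
  the step.\<close>

lemma card_continuations_le:
  assumes "finite U"
  shows "finite (continuations R v U n) \<and> real (card (continuations R v U n)) \<le> (real (card U) / real n) ^ n"
  using assms
proof (induction n arbitrary: v U)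
  case (Suc n)
  let ?N = "{e\<in>U. R v e}" and ?U = "{x\<in>U. \<not> R v x}"
  have fin: "finite ?N" "finite ?U" using Suc.prems by auto
  have "card ?N + card ?U = card (?N \<union> ?U)" using fin by (subst card_Un_disjoint) auto
  also have "?N \<union> ?U = U" by auto
  finally have card: "real (card ?U) = real (card U) - real (card ?N)" by linarith
  have "card ?N \<le> card U" using Suc.prems by (intro card_mono) auto
  have "card (continuations R v U (Suc n)) \<le> (\<Sum>e\<in>?N. card ((#) e ` continuations R e ?U n))"
    using fin by (simp add: card_UN_le)
  also have "\<dots> = (\<Sum>e\<in>?N. card (continuations R e ?U n))"
    by (intro sum.cong refl card_image) (simp add: inj_on_def)
  finally have "real (card (continuations R v U (Suc n))) \<le> (\<Sum>e\<in>?N. real (card (continuations R e ?U n)))"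
    by (simp only: of_nat_le_iff flip: of_nat_sum)
  also have "\<dots> \<le> (\<Sum>e\<in>?N. (real (card ?U) / real n) ^ n)"
    using Suc.IH[OF fin(2)] by (intro sum_mono) auto
  also have "\<dots> = real (card ?N) * ((real (card U) - real (card ?N)) / real n) ^ n"
    by (simp add: card)
  also have "\<dots> \<le> (real (card U) / real (Suc n)) ^ Suc n"
    using \<open>card ?N \<le> card U\<close> by (intro mult_power_le_power_mean) auto
  finally show ?case using fin Suc.IH[OF fin(2)] by auto
qed simp

text \<open>The first term is any element of \<open>E\<close>; before it nothing has been excluded,
  so its continuations are drawn from all of \<open>E\<close>.\<close>

lemma card_induced_chains_le:
  fixes R :: "'a \<Rightarrow> 'a \<Rightarrow> bool" and n :: nat
  assumes "finite E"
  defines "Q \<equiv> {xs. induced_chain R xs \<and> set xs \<subseteq> E \<and> length xs = Suc n}"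
  shows "finite Q" "real (card Q) \<le> real (card E) * (real (card E) / real n) ^ n"
proof -
  let ?C = "\<lambda>e. (#) e ` continuations R e E n"
  have "Q \<subseteq> (\<Union>e\<in>E. ?C e)"
  proof
    fix xs assume xs: "xs \<in> Q"
    then obtain e ys where "xs = e # ys" "length ys = n" by (auto simp: Q_def length_Suc_conv)
    then show "xs \<in> (\<Union>e\<in>E. ?C e)"
      using xs induced_chain_in_continuations[of R e ys E] by (auto simp: Q_def)
  qed
  moreover have fin: "finite (\<Union>e\<in>E. ?C e)"
    using assms card_continuations_le[OF assms(1)] by auto
  ultimately show "finite Q" by (rule finite_subset)
  have "card Q \<le> card (\<Union>e\<in>E. ?C e)" using \<open>Q \<subseteq> _\<close> fin by (intro card_mono)
  also have "\<dots> \<le> (\<Sum>e\<in>E. card (?C e))" using assms by (intro card_UN_le)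
  also have "\<dots> = (\<Sum>e\<in>E. card (continuations R e E n))"
    by (intro sum.cong refl card_image) (simp add: inj_on_def)
  finally have "real (card Q) \<le> (\<Sum>e\<in>E. real (card (continuations R e E n)))"
    by (simp only: of_nat_le_iff flip: of_nat_sum)
  also have "\<dots> \<le> (\<Sum>e\<in>E. (real (card E) / real n) ^ n)"
    using card_continuations_le[OF assms(1)] by (intro sum_mono) auto
  finally show "real (card Q) \<le> real (card E) * (real (card E) / real n) ^ n" by simp
qed

text \<open>Choice gives two sections \<open>p\<close> and \<open>q\<close> of \<open>f\<close> over
  \<open>X\<close>. Their images are disjoint: a common value would belong to a single
  \<open>S\<close>, where they differ.\<close>

lemma two_mult_card_le_card_fibres:
  assumes "finite Q" "\<And>S. S \<in> X \<Longrightarrow> \<exists>p\<in>Q. \<exists>q\<in>Q. p \<noteq> q \<and> f p = S \<and> f q = S"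
  shows "2 * card X \<le> card Q"
proof -
  obtain p q where pq: "\<And>S. S \<in> X \<Longrightarrow> p S \<in> Q \<and> q S \<in> Q \<and> p S \<noteq> q S \<and> f (p S) = S \<and> f (q S) = S"
    using assms(2) by metis
  have inj: "inj_on p X" "inj_on q X" using pq by (metis inj_onI)+
  have sub: "p ` X \<subseteq> Q" "q ` X \<subseteq> Q" using pq by auto
  have "p s \<noteq> q t" if "s \<in> X" "t \<in> X" for s t
    using pq[OF that(1)] pq[OF that(2)] by metis
  then have "p ` X \<inter> q ` X = {}" by blast
  then have "card (p ` X \<union> q ` X) = 2 * card X"
    using inj sub assms(1) by (subst card_Un_disjoint) (auto simp: card_image intro: finite_subset)
  moreover have "card (p ` X \<union> q ` X) \<le> card Q" using sub assms(1) by (intro card_mono) auto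
  ultimately show ?thesis by simp
qed

section \<open>Induced paths and their alternate edges\<close>

lemma verts_path_graph [simp]: "verts (path_graph k) = {..<k}"
  by (simp add: path_graph_def)

lemma path_graph_edge_iff:
  "{i, j} \<in> edges (path_graph k) \<longleftrightarrow> (j = Suc i \<and> j < k) \<or> (i = Suc j \<and> i < k)"
  by (auto simp: path_graph_def doubleton_eq_iff)

definition alternate_edges :: "nat \<Rightarrow> (nat \<Rightarrow> 'a) \<Rightarrow> 'a set list" where
  "alternate_edges l g = map (\<lambda>i. {g (2 * i), g (Suc (2 * i))}) [0..<l]"

text \<open>For \<open>i < j\<close> the only adjacency possible between the two edges joins
  positions \<open>Suc (2 * i)\<close> and \<open>2 * j\<close>, and it forces
  \<open>j = Suc i\<close>. An edge is also related to itself, which \<open>induced_chain\<close>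
  tolerates because it constrains only pairs with \<open>i < j\<close>.\<close>

lemma alternate_edges_of_induced_path:
  assumes g: "bij_betw g {..<2 * l} S"
    and adj: "\<And>i j. i < 2 * l \<Longrightarrow> j < 2 * l \<Longrightarrow> {g i, g j} \<in> E \<longleftrightarrow> j = Suc i \<or> i = Suc j"
  defines "p \<equiv> alternate_edges l g"
  shows "induced_chain (\<lambda>a b. \<exists>u\<in>a. \<exists>v\<in>b. {u, v} \<in> E) p" "set p \<subseteq> E" "length p = l" "\<Union>(set p) = S"
proof -
  show "induced_chain (\<lambda>a b. \<exists>u\<in>a. \<exists>v\<in>b. {u, v} \<in> E) p"
    unfolding induced_chain_def
  proof (intro allI impI)
    fix i j assume ij: "i < j" "j < length p"
    then have b: "2 * i < 2 * l" "Suc (2 * i) < 2 * l" "2 * j < 2 * l" "Suc (2 * j) < 2 * l"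
      by (auto simp: p_def alternate_edges_def)
    show "(\<exists>u\<in>p ! i. \<exists>v\<in>p ! j. {u, v} \<in> E) \<longleftrightarrow> j = Suc i"
      using ij adj[OF b(1) b(3)] adj[OF b(1) b(4)] adj[OF b(2) b(3)] adj[OF b(2) b(4)]
      by (auto simp: p_def alternate_edges_def)
  qed
  show "set p \<subseteq> E" using adj by (auto simp: p_def alternate_edges_def)
  show "length p = l" by (simp add: p_def alternate_edges_def)
  let ?e = "\<lambda>i. {g (2 * i), g (Suc (2 * i))}"
  have "(\<Union>i<l. ?e i) = g ` {..<2 * l}"
  proof (intro equalityI subsetI)
    fix x assume "x \<in> g ` {..<2 * l}"
    then obtain i where i: "i < 2 * l" "x = g i" by auto
    then have "x \<in> ?e (i div 2)" by (cases "even i") auto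
    then show "x \<in> (\<Union>i<l. ?e i)" using i by auto
  qed auto
  then show "\<Union>(set p) = S" using g by (auto simp: p_def alternate_edges_def bij_betw_def lessThan_atLeast0)
qed

text \<open>The two chains come from reading the path from either end: \<open>h\<close> is
  \<open>g\<close> reversed.\<close>

lemma induced_path_two_chains:
  assumes l: "l \<ge> 2" and iso: "graph_iso (induced_subgraph G S) (path_graph (2 * l))"
  defines "R \<equiv> \<lambda>a b. \<exists>u\<in>a. \<exists>v\<in>b. {u, v} \<in> edges G"
  defines "Q \<equiv> {p. induced_chain R p \<and> set p \<subseteq> edges G \<and> length p = l}"
  shows "\<exists>p\<in>Q. \<exists>q\<in>Q. p \<noteq> q \<and> \<Union>(set p) = S \<and> \<Union>(set q) = S"
proof -
  obtain f where f: "bij_betw f S {..<2 * l}"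
    and f_iso: "\<forall>u\<in>S. \<forall>v\<in>S. {u, v} \<in> {e \<in> edges G. e \<subseteq> S} \<longleftrightarrow> {f u, f v} \<in> edges (path_graph (2 * l))"
    using iso unfolding graph_iso_def induced_subgraph_def fst_conv snd_conv verts_path_graph by blast
  have f_adj: "{u, v} \<in> edges G \<longleftrightarrow> {f u, f v} \<in> edges (path_graph (2 * l))" if "u \<in> S" "v \<in> S" for u v
    using f_iso that by blast
  define g where "g = the_inv_into S f"
  have g: "bij_betw g {..<2 * l} S" using f by (simp add: g_def bij_betw_the_inv_into)
  have fg: "f (g i) = i" "g i \<in> S" if "i < 2 * l" for i
    using that f g by (auto simp: g_def bij_betw_def f_the_inv_into_f)
  have adj: "{g i, g j} \<in> edges G \<longleftrightarrow> j = Suc i \<or> i = Suc j" if "i < 2 * l" "j < 2 * l" for i j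
    using that f_adj[of "g i" "g j"] fg by (auto simp: path_graph_edge_iff)
  define h where "h = (\<lambda>i. g (2 * l - 1 - i))"
  have "bij_betw (\<lambda>i. 2 * l - 1 - i) {..<2 * l} {..<2 * l}"
    by (rule bij_betw_byWitness[where f' = "\<lambda>i. 2 * l - 1 - i"]) auto
  then have h: "bij_betw h {..<2 * l} S"
    using bij_betw_trans[OF _ g] by (simp add: h_def comp_def)
  have h_adj: "{h i, h j} \<in> edges G \<longleftrightarrow> j = Suc i \<or> i = Suc j" if "i < 2 * l" "j < 2 * l" for i j
  proof -
    have "2 * l - 1 - j = Suc (2 * l - 1 - i) \<longleftrightarrow> i = Suc j" "2 * l - 1 - i = Suc (2 * l - 1 - j) \<longleftrightarrow> j = Suc i"
      using that by arith+
    moreover have "2 * l - 1 - i < 2 * l" "2 * l - 1 - j < 2 * l" using that by linarith+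
    ultimately show ?thesis unfolding h_def using adj by blast
  qed
  let ?p = "alternate_edges l"
  note chain = alternate_edges_of_induced_path[where E = "edges G"]
  \<comment> \<open>The first edges lie at opposite ends of the path. Were they equal, position 0
    would be \<open>2 * l - 1\<close> or \<open>2 * l - 2\<close>, impossible for
    \<open>l \<ge> 2\<close>.\<close>
  have "?p g ! 0 \<noteq> ?p h ! 0"
  proof
    assume "?p g ! 0 = ?p h ! 0"
    then have "{g 0, g 1} = {g (2 * l - 1), g (2 * l - 2)}"
      using l by (simp add: alternate_edges_def h_def numeral_2_eq_2)
    then have "f (g 0) \<in> {f (g (2 * l - 1)), f (g (2 * l - 2))}" by (auto simp: doubleton_eq_iff)
    then show False using l fg by auto
  qed
  then have "?p g \<noteq> ?p h" by auto
  moreover have "?p g \<in> Q \<and> \<Union>(set (?p g)) = S"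
    using chain[OF g adj] unfolding Q_def R_def by blast
  moreover have "?p h \<in> Q \<and> \<Union>(set (?p h)) = S"
    using chain[OF h h_adj] unfolding Q_def R_def by blast
  ultimately show ?thesis by blast
qed

text \<open>Sending a chain to the union of its edges hits every induced copy at least twice, which
  yields the factor 2 in the denominator.\<close>

lemma induced_copies_path_graph_le:
  assumes l: "l \<ge> 2" and G: "simple_graph G"
  shows "real (induced_copies G (path_graph (2 * l)))
           \<le> real (card (edges G)) ^ l / (2 * (real l - 1) ^ (l - 1))"
proof -
  define R where "R = (\<lambda>a b. \<exists>u\<in>a. \<exists>v\<in>b. {u, v} \<in> edges G)"
  define Q where "Q = {p. induced_chain R p \<and> set p \<subseteq> edges G \<and> length p = Suc (l - 1)}"
  have "edges G \<subseteq> Pow (verts G)" "finite (verts G)" using G by (auto simp: simple_graph_def)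
  then have fin: "finite (edges G)" by (meson finite_Pow_iff finite_subset)
  note Q = card_induced_chains_le[OF fin, of R "l - 1", folded Q_def]
  have "2 * induced_copies G (path_graph (2 * l)) \<le> card Q"
    unfolding induced_copies_def
  proof (rule two_mult_card_le_card_fibres[OF Q(1), where f = "\<lambda>p. \<Union>(set p)"])
    fix S assume "S \<in> {S. S \<subseteq> verts G \<and> graph_iso (induced_subgraph G S) (path_graph (2 * l))}"
    then have "graph_iso (induced_subgraph G S) (path_graph (2 * l))" by simp
    moreover have "Q = {p. induced_chain R p \<and> set p \<subseteq> edges G \<and> length p = l}"
      using l by (simp add: Q_def)
    ultimately show "\<exists>p\<in>Q. \<exists>q\<in>Q. p \<noteq> q \<and> \<Union>(set p) = S \<and> \<Union>(set q) = S"
      using induced_path_two_chains[OF l, of G S] by (simp only: R_def)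
  qed
  then have "2 * real (induced_copies G (path_graph (2 * l))) \<le> real (card Q)" by linarith
  also have "\<dots> \<le> real (card (edges G)) ^ Suc (l - 1) / real (l - 1) ^ (l - 1)"
    using Q(2) by (simp add: power_divide)
  also have "\<dots> = real (card (edges G)) ^ l / (real l - 1) ^ (l - 1)"
    using l by (simp add: of_nat_diff)
  finally show ?thesis by (simp add: field_simps)
qed

section \<open>The lower bound\<close>

text \<open>The vertex \<open>x < k * n\<close> lies in part \<open>x mod k\<close> of the blow-up.\<close>

definition cycle_blowup_edges :: "nat \<Rightarrow> nat \<Rightarrow> nat set set" where
  "cycle_blowup_edges k n = {{x, y} | x y. x < k * n \<and> y < k * n \<and> Suc x mod k = y mod k}"

lemma cycle_blowup_edge_iff:
  assumes "u < k * n" "v < k * n"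
  shows "{u, v} \<in> cycle_blowup_edges k n \<longleftrightarrow> Suc u mod k = v mod k \<or> Suc v mod k = u mod k"
  unfolding cycle_blowup_edges_def mem_Collect_eq doubleton_eq_iff using assms by blast

lemma Suc_mod_neq_mod:
  assumes "k \<ge> 2"
  shows "Suc x mod k \<noteq> x mod k"
  using assms by (simp add: mod_Suc)

text \<open>An edge is given by an endpoint \<open>x\<close> and one of the \<open>n\<close>
  vertices of the part following that of \<open>x\<close>. Equality fails in general: for
  \<open>k = 2\<close> every edge is described twice.\<close>

lemma card_cycle_blowup_edges:
  shows "finite (cycle_blowup_edges k n)" "card (cycle_blowup_edges k n) \<le> k * n\<^sup>2"
proof -
  let ?f = "\<lambda>(x, a). {x, Suc x mod k + k * a}"
  have sub: "cycle_blowup_edges k n \<subseteq> ?f ` ({..<k * n} \<times> {..<n})"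
  proof
    fix e assume "e \<in> cycle_blowup_edges k n"
    then obtain x y where e: "e = {x, y}" "x < k * n" "y < k * n" "Suc x mod k = y mod k"
      by (auto simp: cycle_blowup_edges_def)
    then have "e = ?f (x, y div k)" by (simp add: mult.commute)
    moreover have "y div k < n" using e by (simp add: less_mult_imp_div_less mult.commute)
    ultimately show "e \<in> ?f ` ({..<k * n} \<times> {..<n})" using e by blast
  qed
  then show "finite (cycle_blowup_edges k n)" by (rule finite_subset) simp
  have "card (cycle_blowup_edges k n) \<le> card ({..<k * n} \<times> {..<n})"
    using sub by (intro surj_card_le) auto
  then show "card (cycle_blowup_edges k n) \<le> k * n\<^sup>2" by (simp add: power2_eq_square mult.assoc)
qed

text \<open>The \<open>r\<close> disjoint edges on fresh vertices allow the number of edges to be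
  adjusted to exactly \<open>m\<close>.\<close>

definition padded_blowup :: "nat \<Rightarrow> nat \<Rightarrow> nat \<Rightarrow> nat graph" where
  "padded_blowup k n r =
     ({..<k * n + 2 * r}, cycle_blowup_edges k n \<union> (\<lambda>j. {k * n + 2 * j, Suc (k * n + 2 * j)}) ` {..<r})"

lemma simple_graph_padded_blowup:
  assumes "k \<ge> 2"
  shows "simple_graph (padded_blowup k n r)"
proof -
  have "e \<subseteq> {..<k * n} \<and> card e = 2" if e: "e \<in> cycle_blowup_edges k n" for e
  proof -
    obtain x y where xy: "e = {x, y}" "x < k * n" "y < k * n" "Suc x mod k = y mod k"
      using e unfolding cycle_blowup_edges_def by blast
    have "x \<noteq> y" using xy(4) Suc_mod_neq_mod[OF assms, of x] by metis
    then show ?thesis using xy(1-3) by simp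
  qed
  then show ?thesis
    unfolding simple_graph_def padded_blowup_def by fastforce
qed

lemma card_edges_padded_blowup:
  "card (edges (padded_blowup k n r)) = card (cycle_blowup_edges k n) + r"
proof -
  let ?h = "\<lambda>j. {k * n + 2 * j, Suc (k * n + 2 * j)}"
  have "inj_on ?h {..<r}" by (auto simp: inj_on_def doubleton_eq_iff)
  moreover have "cycle_blowup_edges k n \<inter> ?h ` {..<r} = {}"
    by (auto simp: cycle_blowup_edges_def doubleton_eq_iff)
  ultimately show ?thesis
    by (simp add: padded_blowup_def card_Un_disjoint card_image card_cycle_blowup_edges)
qed

text \<open>Deleting one vertex from a cycle leaves a path. Here the residue \<open>c\<close> is
  deleted, and the path starts at the residue following it cyclically.\<close>

lemma transversal_induces_path:
  assumes k: "k \<ge> 2" and c: "c < k" and S: "S \<subseteq> {..<k * n}"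
    and trans: "bij_betw (\<lambda>x. x mod k) S ({..<k} - {c})"
  shows "graph_iso (induced_subgraph (padded_blowup k n r) S) (path_graph (k - 1))"
proof -
  \<comment> \<open>This rotation moves the missing residue \<open>c\<close> to
    \<open>k - 1\<close>; adding \<open>Suc c\<close> undoes it modulo \<open>k\<close>.\<close>
  define f where "f x = (x + (k - 1 - c)) mod k" for x
  have f_mod: "f x = f y \<longleftrightarrow> x mod k = y mod k" for x y
  proof
    assume "f x = f y"
    then have "(x + (k - 1 - c) + Suc c) mod k = (y + (k - 1 - c) + Suc c) mod k"
      unfolding f_def by (rule mod_add_cong) (rule refl)
    then show "x mod k = y mod k" using c by simp
  next
    assume "x mod k = y mod k"
    then show "f x = f y" unfolding f_def by (rule mod_add_cong) (rule refl)
  qed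
  have f_less: "f x < k - 1" if "x \<in> S" for x
  proof -
    have "x mod k \<noteq> c mod k" using trans that c by (auto simp: bij_betw_def)
    then have "f x \<noteq> f c" using f_mod by simp
    moreover have "f c = k - 1" "f x < k" using c k by (auto simp: f_def)
    ultimately show ?thesis by linarith
  qed
  have "inj_on f S" using trans f_mod by (auto simp: bij_betw_def inj_on_def)
  moreover have "card S = k - 1" using bij_betw_same_card[OF trans] c by simp
  ultimately have "f ` S = {..<k - 1}" using f_less by (intro card_subset_eq) (auto simp: card_image)
  with \<open>inj_on f S\<close> have bij: "bij_betw f S {..<k - 1}" by (simp add: bij_betw_def)
  \<comment> \<open>As \<open>k - 1\<close> is not attained on \<open>S\<close>, the cyclic
    successor never wraps around and is the ordinary one.\<close>
  have Suc_f: "f (Suc u) = Suc (f u)" if "u \<in> S" for u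
    using f_less[OF that] by (simp add: f_def mod_Suc)
  have "{u, v} \<in> edges (padded_blowup k n r) \<longleftrightarrow> {f u, f v} \<in> edges (path_graph (k - 1))"
    if uv: "u \<in> S" "v \<in> S" for u v
  proof -
    have less: "u < k * n" "v < k * n" using uv S by auto
    then have "{u, v} \<in> edges (padded_blowup k n r) \<longleftrightarrow> {u, v} \<in> cycle_blowup_edges k n"
      by (auto simp: padded_blowup_def doubleton_eq_iff)
    also have "\<dots> \<longleftrightarrow> f (Suc u) = f v \<or> f (Suc v) = f u"
      using less by (simp add: cycle_blowup_edge_iff f_mod)
    also have "\<dots> \<longleftrightarrow> {f u, f v} \<in> edges (path_graph (k - 1))"
      using uv f_less by (auto simp: Suc_f path_graph_edge_iff)
    finally show ?thesis .
  qed
  with bij show ?thesis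
    by (auto simp: graph_iso_def induced_subgraph_def path_graph_def)
qed

text \<open>\<open>D\<close> consists of an omitted part \<open>c\<close> and a choice
  \<open>a\<close> of one vertex in each other part. From the set \<open>T (c, a)\<close>, residues
  modulo \<open>k\<close> recover \<open>c\<close> and quotients by \<open>k\<close> recover
  \<open>a\<close>, so distinct choices give distinct copies.\<close>

lemma induced_copies_padded_blowup_ge:
  assumes k: "k \<ge> 2"
  shows "k * n ^ (k - 1) \<le> induced_copies (padded_blowup k n r) (path_graph (k - 1))"
proof -
  define D where "D = (SIGMA c:{..<k}. PiE ({..<k} - {c}) (\<lambda>_. {..<n}))"
  define T where "T = (\<lambda>(c, a). (\<lambda>i. i + k * a i) ` ({..<k} - {c}))"
  have mod_T: "(\<lambda>x. x mod k) ` T (c, a) = {..<k} - {c}" for c a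
    by (auto simp: T_def image_image)
  have "card D = (\<Sum>c<k. n ^ (k - 1))"
    unfolding D_def by (subst card_SigmaI) (auto simp: card_PiE finite_PiE)
  then have "card D = k * n ^ (k - 1)" by simp
  moreover have "inj_on T D"
  proof (rule inj_onI, clarify)
    fix c a d b assume D: "(c, a) \<in> D" "(d, b) \<in> D" and eq: "T (c, a) = T (d, b)"
    then have "{..<k} - {c} = {..<k} - {d}" "c < k" "d < k"
      using mod_T[of c a] mod_T[of d b] by (simp_all add: D_def)
    then have cd: "c = d" by auto
    have "a i = b i" if i: "i \<in> {..<k} - {c}" for i
    proof -
      have "i + k * a i \<in> T (d, b)" using i eq by (auto simp: T_def)
      then obtain j where "j < k" "i + k * a i = j + k * b j" by (auto simp: T_def)
      then have "(i + k * a i) div k = (j + k * b j) div k" "(i + k * a i) mod k = (j + k * b j) mod k"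
        by (simp_all only:)
      then show ?thesis using i \<open>j < k\<close> by simp
    qed
    then have "a = b" using D cd by (intro PiE_ext) (auto simp: D_def)
    with cd show "c = d \<and> a = b" by simp
  qed
  moreover have "T ` D \<subseteq> {S. S \<subseteq> verts (padded_blowup k n r) \<and>
      graph_iso (induced_subgraph (padded_blowup k n r) S) (path_graph (k - 1))}"
  proof clarify
    fix c a assume D: "(c, a) \<in> D"
    have "i + k * a i < k * n" if "i \<in> {..<k} - {c}" for i
    proof -
      have "i < k" "Suc (a i) \<le> n" using D that by (auto simp: D_def PiE_def Pi_def Suc_le_eq)
      then have "i + k * a i < k * Suc (a i)" "k * Suc (a i) \<le> k * n" by (simp, intro mult_le_mono2)
      then show ?thesis by linarith
    qed
    then have sub: "T (c, a) \<subseteq> {..<k * n}" by (auto simp: T_def)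
    have "inj_on (\<lambda>x. x mod k) (T (c, a))" by (auto simp: T_def inj_on_def)
    then have "graph_iso (induced_subgraph (padded_blowup k n r) (T (c, a))) (path_graph (k - 1))"
      using D mod_T sub k by (intro transversal_induces_path[where c = c]) (auto simp: D_def bij_betw_def)
    then show "T (c, a) \<subseteq> verts (padded_blowup k n r) \<and>
        graph_iso (induced_subgraph (padded_blowup k n r) (T (c, a))) (path_graph (k - 1))"
      using sub by (auto simp: padded_blowup_def)
  qed
  then have "card (T ` D) \<le> induced_copies (padded_blowup k n r) (path_graph (k - 1))"
    unfolding induced_copies_def by (intro card_mono) (auto simp: padded_blowup_def)
  ultimately show ?thesis by (simp add: card_image)
qed

section \<open>Bounds for the maximum over graphs with a given number of edges\<close>

lemma max_induced_copies_path_graph_ge: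
  assumes "l \<ge> 1" and n: "(2 * l + 1) * n\<^sup>2 \<le> m"
  shows "(2 * l + 1) * n ^ (2 * l) \<le> max_induced_copies (path_graph (2 * l)) m"
proof -
  let ?k = "2 * l + 1"
  \<comment> \<open>The natural-number subtraction does not truncate, since the blow-up has at most
    \<open>?k * n\<^sup>2 \<le> m\<close> edges.\<close>
  define G where "G = padded_blowup ?k n (m - card (cycle_blowup_edges ?k n))"
  have "card (edges G) = m"
    using card_cycle_blowup_edges(2)[of ?k n] n by (simp add: G_def card_edges_padded_blowup)
  moreover have "simple_graph G" using assms(1) by (auto simp: G_def intro: simple_graph_padded_blowup)
  ultimately have "induced_copies G (path_graph (2 * l)) \<le> max_induced_copies (path_graph (2 * l)) m"
    unfolding max_induced_copies_def
    using assms(1) by (intro Max_ge finite_induced_copies_path_graph CollectI exI[of _ G]) auto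
  moreover have "?k * n ^ (2 * l) \<le> induced_copies G (path_graph (2 * l))"
    using induced_copies_padded_blowup_ge[of ?k] assms(1) by (simp add: G_def)
  ultimately show ?thesis by linarith
qed

lemma max_induced_copies_path_graph_le:
  assumes l: "l \<ge> 2"
  shows "real (max_induced_copies (path_graph (2 * l)) m) \<le> real m ^ l / (2 * (real l - 1) ^ (l - 1))"
proof -
  let ?C = "{induced_copies G (path_graph (2 * l)) | G :: nat graph. simple_graph G \<and> card (edges G) = m}"
  \<comment> \<open>With \<open>n = 0\<close> only the padding remains, a matching with
    \<open>m\<close> edges. It shows that some graph qualifies, so the maximum is attained.\<close>
  have "simple_graph (padded_blowup 2 0 m)" "card (edges (padded_blowup 2 0 m)) = m"
    by (auto simp: simple_graph_padded_blowup card_edges_padded_blowup cycle_blowup_edges_def)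
  then have "?C \<noteq> {}" by blast
  then have "Max ?C \<in> ?C" using l by (intro Max_in finite_induced_copies_path_graph) auto
  then show ?thesis
    using induced_copies_path_graph_le[OF l] by (auto simp: max_induced_copies_def)
qed

text \<open>Rounding the ideal part size down to an integer is the source of the error term in the
  lower bound.\<close>

lemma floor_over_self_tendsto_1:
  "((\<lambda>x::real. of_int \<lfloor>x\<rfloor> / x) \<longlongrightarrow> 1) at_top"
proof (rule tendsto_sandwich)
  have "((\<lambda>x::real. 1 - inverse x) \<longlongrightarrow> 1 - 0) at_top"
    by (intro tendsto_diff tendsto_const tendsto_inverse_0_at_top filterlim_ident)
  then show "((\<lambda>x::real. 1 - inverse x) \<longlongrightarrow> 1) at_top" by simp
  show "\<forall>\<^sub>F x::real in at_top. 1 - inverse x \<le> of_int \<lfloor>x\<rfloor> / x"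
    using eventually_gt_at_top[of 0]
  proof eventually_elim
    case (elim x)
    have "1 - inverse x = (x - 1) / x" using elim by (simp add: field_simps)
    also have "\<dots> \<le> of_int \<lfloor>x\<rfloor> / x" using elim by (intro divide_right_mono) linarith+
    finally show ?case .
  qed
  show "\<forall>\<^sub>F x::real in at_top. of_int \<lfloor>x\<rfloor> / x \<le> 1"
    using eventually_gt_at_top[of 0] by eventually_elim simp
qed simp

theorem theorem1p4:
  fixes l :: nat
  assumes "l \<ge> 2"
  shows "(\<exists>\<epsilon> :: nat \<Rightarrow> real. \<epsilon> \<longlonglongrightarrow> 0 \<and>
            (\<forall>m\<ge>1. (1 + \<epsilon> m) * (2 * real l + 1) * (real m ^ l / (2 * real l + 1) ^ l)
                     \<le> real (max_induced_copies (path_graph (2 * l)) m)))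
         \<and> (\<forall>m\<ge>1. real (max_induced_copies (path_graph (2 * l)) m)
                     \<le> real m ^ l / (2 * (real l - 1) ^ (l - 1)))"
proof
  \<comment> \<open>The ideal real part size, solving
    \<open>(2 * l + 1) * x\<^sup>2 = m\<close>.\<close>
  define x where "x m = sqrt (real m / (2 * real l + 1))" for m :: nat
  \<comment> \<open>With \<open>n\<close> the floor of \<open>x m\<close>, this makes the claimed
    lower bound equal to \<open>(2 * l + 1) * n ^ (2 * l)\<close>, the number of copies found in the
    blow-up.\<close>
  define \<epsilon> where "\<epsilon> m = (of_int \<lfloor>x m\<rfloor> / x m) ^ (2 * l) - 1" for m
  have "filterlim (\<lambda>m. 1 / (2 * real l + 1) * real m) at_top sequentially"
    by (rule filterlim_tendsto_pos_mult_at_top[OF tendsto_const _ filterlim_real_sequentially]) simp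
  then have "filterlim x at_top sequentially"
    unfolding x_def by (intro filterlim_compose[OF sqrt_at_top]) simp
  then have "(\<lambda>m. of_int \<lfloor>x m\<rfloor> / x m) \<longlonglongrightarrow> 1"
    by (rule filterlim_compose[OF floor_over_self_tendsto_1])
  then have "\<epsilon> \<longlonglongrightarrow> 1 ^ (2 * l) - 1"
    unfolding \<epsilon>_def by (intro tendsto_intros)
  moreover have "(1 + \<epsilon> m) * (2 * real l + 1) * (real m ^ l / (2 * real l + 1) ^ l)
      \<le> real (max_induced_copies (path_graph (2 * l)) m)" if "m \<ge> 1" for m
  proof -
    define n where "n = nat \<lfloor>x m\<rfloor>"
    have x: "x m > 0" "(x m)\<^sup>2 = real m / (2 * real l + 1)" using that by (auto simp: x_def)
    then have n: "real n = of_int \<lfloor>x m\<rfloor>" by (simp add: n_def)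
    have "real n \<le> x m" using n by simp
    then have "(real n)\<^sup>2 \<le> (x m)\<^sup>2" using x(1) by (intro power_mono) auto
    then have "real ((2 * l + 1) * n\<^sup>2) \<le> real m" by (simp add: x field_simps)
    then have "(2 * l + 1) * n\<^sup>2 \<le> m" by (simp only: of_nat_le_iff)
    then have "(2 * l + 1) * n ^ (2 * l) \<le> max_induced_copies (path_graph (2 * l)) m"
      using assms by (intro max_induced_copies_path_graph_ge) auto
    then have "real ((2 * l + 1) * n ^ (2 * l)) \<le> real (max_induced_copies (path_graph (2 * l)) m)"
      by (simp only: of_nat_le_iff)
    moreover have "real m ^ l / (2 * real l + 1) ^ l = x m ^ (2 * l)"
      by (simp add: x power_mult power_divide)
    then have "(1 + \<epsilon> m) * (2 * real l + 1) * (real m ^ l / (2 * real l + 1) ^ l) = real ((2 * l + 1) * n ^ (2 * l))"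
      using x by (simp add: \<epsilon>_def n power_divide field_simps)
    ultimately show ?thesis by simp
  qed
  ultimately show "\<exists>\<epsilon> :: nat \<Rightarrow> real. \<epsilon> \<longlonglongrightarrow> 0 \<and>
      (\<forall>m\<ge>1. (1 + \<epsilon> m) * (2 * real l + 1) * (real m ^ l / (2 * real l + 1) ^ l)
         \<le> real (max_induced_copies (path_graph (2 * l)) m))"
    by (intro exI[of _ \<epsilon>]) auto
qed (use max_induced_copies_path_graph_le[OF assms] in blast)

end
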